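(* Let $\beta_1,\beta_2>0$ be real numbers with $2\beta_1-\beta_2\geq 4$. Let $p$ be an analytic function in $\mathbb{D}$ with $p(0)=1$ and $$1+\beta_1 zp'(z)+\beta_2 z^2p''(z)\prec z+\sqrt{1+z^2}.$$ Then $p(z)\prec 1+\sinh^{-1}z$.
   Context: $\mathbb{D}=\{z\in\mathbb{C}:|z|<1\}$. For functions $f,g$ analytic in $\mathbb{D}$, $f\prec g$ ($f$ is subordinate to $g$) means there is an analytic $w:\mathbb{D}\to\mathbb{C}$ with $w(0)=0$ and $|w(z)|\leq|z|$ such that $f(z)=g(w(z))$ for all $z\in\mathbb{D}$. The square root is the principal branch, and $\sinh^{-1}z=\log(z+\sqrt{1+z^2})$ is the principal branch of the inverse hyperbolic sine, analytic on $\mathbb{D}$ with value $0$ at $0$. *)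

theory Defs
  imports "HOL-Complex_Analysis.Complex_Analysis"
begin

abbreviation unit_disc :: "complex set" ("\<bbbD>") where
  "\<bbbD> \<equiv> ball 0 1"

(* Meant for f and g holomorphic on the disc. The values of f, g and w outside the disc are
   irrelevant, since |w z| \<le> |z| makes w map the disc into itself. *)
definition subordinate :: "(complex \<Rightarrow> complex) \<Rightarrow> (complex \<Rightarrow> complex) \<Rightarrow> bool"
    (infix "\<prec>\<^sub>\<bbbD>" 50) where
  "f \<prec>\<^sub>\<bbbD> g \<longleftrightarrow>
    (\<exists>w. w holomorphic_on \<bbbD> \<and> w 0 = 0 \<and> (\<forall>z\<in>\<bbbD>. norm (w z) \<le> norm z) \<and>
         (\<forall>z\<in>\<bbbD>. f z = g (w z)))"

(* The library's generic arsinh, at type complex, is the principal branch. *)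
lemma arsinh_complex_eq: "arsinh z = Ln (z + csqrt (1 + z\<^sup>2))"
proof (cases "z\<^sup>2 + 1 = 0")
  case True
  then show ?thesis by (simp add: arsinh_def add.commute)
next
  case False
  then show ?thesis
    by (simp add: arsinh_def csqrt_conv_powr add.commute)
qed

end

theory Submission
  imports Defs
begin

text \<open>
  The image of the disc under \<open>z + sqrt (1 + z\<^sup>2)\<close> is a lune inside the disc of radius \<open>sqrt 2\<close>
  around \<open>1\<close>, so the Schwarz lemma gives \<open>\<bar>\<beta>\<^sub>1 p' + \<beta>\<^sub>2 z p''\<bar> \<le> sqrt 2\<close>. Integrating this first-order
  equation for \<open>p'\<close> along radii with the factor \<open>t powr (\<beta>\<^sub>1 / \<beta>\<^sub>2)\<close> yields \<open>\<bar>p'\<bar> \<le> sqrt 2 / \<beta>\<^sub>1\<close>.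
  As \<open>\<beta>\<^sub>1 > 2\<close>, it follows that \<open>\<bar>p - 1\<bar> < 1 / sqrt 2\<close>, and on that disc \<open>sinh\<close> takes values in the
  unit disc and is inverted by \<open>arsinh\<close>. Hence \<open>sinh (p - 1)\<close> is the required Schwarz function.
\<close>

text \<open>With \<open>W = w + csqrt (1 + w\<^sup>2)\<close> one has
  \<open>2 * w = W - inverse W\<close>, so \<open>norm w < 1\<close> becomes
  \<open>norm (W\<^sup>2 - 1) < 2 * norm W\<close>. Squaring and cancelling
  \<open>4 * y\<^sup>2\<close> leaves
  \<open>(x\<^sup>2 + y\<^sup>2 - 1)\<^sup>2 < (2 * x)\<^sup>2\<close>. Since \<open>x > 0\<close>,
  roots can be taken, and the result is the disc around 1.\<close>

lemma norm_lune_less_sqrt2: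
  fixes w :: complex
  assumes "norm w < 1"
  shows "norm (w + csqrt (1 + w\<^sup>2) - 1) < sqrt 2"
proof -
  define s W where "s = csqrt (1 + w\<^sup>2)" and "W = w + s"
  define x y where "x = Re W" and "y = Im W"
  have s2: "s\<^sup>2 = 1 + w\<^sup>2" by (simp add: s_def)
  have "norm (w\<^sup>2) < 1" using assms by (simp add: norm_power power_less_one_iff)
  then have "Re (1 + w\<^sup>2) > 0" using abs_Re_le_cmod[of "w\<^sup>2"] by simp
  then have "(Re s)\<^sup>2 > (Im s)\<^sup>2" by (simp flip: s2 add: Re_power2)
  then have "Re s \<noteq> 0" using zero_le_power2[of "Im s"] by auto
  moreover have "Re s \<ge> 0" using csqrt_principal[of "1 + w\<^sup>2"] by (auto simp: s_def)
  ultimately have Re_s: "Re s > 0" by simp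
  have inv: "W * (s - w) = 1"
    using s2 by (simp add: W_def algebra_simps power2_eq_square)
  then have W0: "W \<noteq> 0" by auto
  have sw: "s - w = inverse W" using inv by (simp add: inverse_unique)
  \<comment> \<open>\<open>W\<close> and \<open>inverse W\<close> have real parts of the same sign,
    and these add up to \<open>2 * Re s > 0\<close>.\<close>
  have "2 * Re s = Re (W + (s - w))" by (simp add: W_def)
  also have "\<dots> = Re W + Re (inverse W)" by (simp add: sw)
  also have "\<dots> = x * (1 + 1 / (x\<^sup>2 + y\<^sup>2))" by (simp add: x_def y_def algebra_simps)
  finally have "x * (1 + 1 / (x\<^sup>2 + y\<^sup>2)) > 0" using Re_s by simp
  moreover have "1 + 1 / (x\<^sup>2 + y\<^sup>2) > 0" by (simp add: add_pos_nonneg)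
  ultimately have x: "x > 0" by (simp add: zero_less_mult_iff)
  have "W\<^sup>2 - 1 = 2 * w * W"
    using s2 by (simp add: W_def algebra_simps power2_eq_square)
  then have "norm (W\<^sup>2 - 1) = 2 * norm w * norm W" by (simp add: norm_mult)
  also have "\<dots> < 2 * norm W" using W0 assms by simp
  finally have "(norm (W\<^sup>2 - 1))\<^sup>2 < (2 * norm W)\<^sup>2" by (intro power_strict_mono) auto
  moreover have "(norm (W\<^sup>2 - 1))\<^sup>2 = (x\<^sup>2 + y\<^sup>2 - 1)\<^sup>2 + 4 * y\<^sup>2"
    unfolding cmod_power2 x_def y_def minus_complex.simps one_complex.simps Re_power2 Im_power2
    by algebra
  moreover have "(2 * norm W)\<^sup>2 = (2 * x)\<^sup>2 + 4 * y\<^sup>2"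
    by (simp add: power_mult_distrib cmod_power2 x_def y_def)
  ultimately have "(x\<^sup>2 + y\<^sup>2 - 1)\<^sup>2 < (2 * x)\<^sup>2" by linarith
  from power2_less_imp_less[OF this] have "x\<^sup>2 + y\<^sup>2 - 1 < 2 * x" using x by simp
  moreover have "(norm (W - 1))\<^sup>2 = x\<^sup>2 + y\<^sup>2 + 1 - 2 * x"
    unfolding cmod_power2 x_def y_def minus_complex.simps one_complex.simps by algebra
  ultimately have "(norm (W - 1))\<^sup>2 < 2" by linarith
  then show ?thesis by (simp add: W_def s_def real_less_rsqrt)
qed

lemma abs_le_inverse_sqrt2_imp_cosh_le:
  fixes x :: real
  assumes "\<bar>x\<bar> \<le> 1 / sqrt 2"
  shows "cosh x \<le> sqrt 2"
proof -
  define t where "t = exp \<bar>x\<bar>"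
  have "1 / sqrt 2 = sqrt 2 / 2" by (simp add: field_simps)
  then have half: "\<bar>x\<bar> \<le> sqrt 2 / 2" using assms by metis
  have sq: "\<bar>x\<bar>\<^sup>2 \<le> 1 / 2" using power_mono[OF assms, of 2] by (simp add: power_divide)
  have "\<bar>x\<bar> \<le> 1" using sq by (intro iffD1[OF abs_square_le_1]) simp
  then have "t \<le> 1 + \<bar>x\<bar> + \<bar>x\<bar>\<^sup>2" unfolding t_def by (intro exp_bound) auto
  \<comment> \<open>Here 1 + sqrt 2 / 2 + 1 / 2 \<le> 1 + sqrt 2, because sqrt 2 \<ge> 1.\<close>
  then have t: "t \<le> 1 + sqrt 2" using half sq real_sqrt_ge_one[of 2] by linarith
  have t1: "t \<ge> 1" by (simp add: t_def)
  have "sqrt 2 - 1 \<le> t" using t1 sqrt2_less_2 by linarith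
  \<comment> \<open>The numbers sqrt 2 - 1 and sqrt 2 + 1 are the roots of
    \<open>t * t - 2 * sqrt 2 * t + 1\<close>, so \<open>t\<close> between them means
    \<open>cosh x \<le> sqrt 2\<close>.\<close>
  then have "(t - (sqrt 2 - 1)) * (1 + sqrt 2 - t) \<ge> 0" using t by simp
  then have "t * t + 1 \<le> 2 * sqrt 2 * t" by (simp add: algebra_simps)
  then have "(t + inverse t) / 2 \<le> sqrt 2" using t1 by (simp add: field_simps)
  moreover have "cosh x = cosh \<bar>x\<bar>" by (simp add: abs_if)
  ultimately show ?thesis by (simp add: t_def cosh_field_def exp_minus)
qed

text \<open>The derivative \<open>cosh\<close> is bounded by sqrt 2 on this disc because
  \<open>norm (cosh v) \<le> cosh (Re v)\<close>; integrating from 0 gives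
  \<open>norm (sinh u) \<le> sqrt 2 * norm u\<close>.\<close>

lemma norm_sinh_less_1:
  fixes u :: complex
  assumes "norm u < 1 / sqrt 2"
  shows "norm (sinh u) < 1"
proof -
  have cosh: "norm (cosh v) \<le> sqrt 2" if "v \<in> ball 0 (1 / sqrt 2)" for v :: complex
  proof -
    have "norm (cosh v) \<le> (norm (exp v) + norm (exp (- v))) / 2"
      by (simp add: cosh_field_def norm_divide norm_triangle_ineq del: norm_exp_eq_Re)
    also have "\<dots> = cosh (Re v)" by (simp add: cosh_field_def)
    also have "\<dots> \<le> sqrt 2"
      using that abs_Re_le_cmod[of v] by (intro abs_le_inverse_sqrt2_imp_cosh_le) simp
    finally show ?thesis .
  qed
  have "norm (sinh u - sinh 0) \<le> sqrt 2 * norm (u - 0)"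
    by (rule field_differentiable_bound[where S = "ball 0 (1 / sqrt 2)" and f' = cosh])
      (use assms cosh in \<open>auto intro!: derivative_eq_intros\<close>)
  also have "\<dots> < 1" using assms by (simp add: field_simps)
  finally show ?thesis by simp
qed

text \<open>In this strip \<open>cosh u\<close> has positive real part, so it is the principal root
  of \<open>1 + (sinh u)\<^sup>2\<close>. What remains is \<open>Ln (exp u)\<close>.\<close>

lemma arsinh_sinh_complex:
  fixes u :: complex
  assumes "\<bar>Im u\<bar> < pi / 2"
  shows "arsinh (sinh u) = u"
proof -
  have "Re (cosh u) = cosh (Re u) * cos (Im u)"
    by (simp add: cosh_field_def Re_exp algebra_simps)
  then have "Re (cosh u) > 0" using assms by (auto intro!: mult_pos_pos cos_gt_zero_pi)
  then have "csqrt ((cosh u)\<^sup>2) = cosh u" by (intro csqrt_square) auto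
  then have "csqrt (1 + (sinh u)\<^sup>2) = cosh u" by (simp add: cosh_square_eq add.commute)
  then show ?thesis
    using assms by (simp add: arsinh_complex_eq sinh_plus_cosh Ln_exp)
qed

text \<open>The integrating factor \<open>t powr c\<close> with \<open>c = a / b\<close> turns the
  bounded expression, taken at \<open>t * z\<close>, into the derivative of
  \<open>t powr c * r (t * z)\<close>, up to the factor \<open>t powr (c - 1) / b\<close>.
  Integrating \<open>M / b * t powr (c - 1)\<close> over [0, 1] gives \<open>M / a\<close>.\<close>

lemma first_order_euler_bound:
  fixes r :: "complex \<Rightarrow> complex" and a b M :: real
  assumes r: "r holomorphic_on \<bbbD>" and "a > 0" "b > 0"
    and bound: "\<And>z. z \<in> \<bbbD> \<Longrightarrow> norm (of_real a * r z + of_real b * z * deriv r z) \<le> M"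
    and z: "z \<in> \<bbbD>"
  shows "norm (r z) \<le> M / a"
proof -
  define c where "c = a / b"
  have c: "c > 0" using assms by (simp add: c_def)
  define f where "f = (\<lambda>t. of_real (t powr c) * r (of_real t * z))"
  define f' where "f' = (\<lambda>t. of_real (t powr (c - 1) / b) *
     (of_real a * r (of_real t * z) + of_real b * (of_real t * z) * deriv r (of_real t * z)))"
  have mem: "of_real t * z \<in> \<bbbD>" if "0 \<le> t" "t \<le> 1" for t
    using that z mult_left_le_one_le[of "norm z" t] by (simp add: norm_mult)
  have powr: "continuous_on {0..1} (\<lambda>t::real. t powr c)"
    using c by (intro continuous_on_powr') auto
  \<comment> \<open>Both terms at 0 vanish since \<open>0 powr c = 0\<close>, while
    \<open>f 1 = r z\<close>.\<close>
  have "norm (f 1 - f 0) \<le> M / a * 1 powr c - M / a * 0 powr c"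
  proof (rule differentiable_bound_general[where f' = f' and \<phi>' = "\<lambda>t. M / b * t powr (c - 1)"])
    have "continuous_on {0..1} (\<lambda>t. r (of_real t * z))"
      by (rule continuous_on_compose2[OF holomorphic_on_imp_continuous_on[OF r]])
        (use mem in \<open>auto intro!: continuous_intros\<close>)
    then show "continuous_on {0..1} f"
      unfolding f_def by (intro continuous_on_mult continuous_on_of_real powr)
    show "continuous_on {0..1} (\<lambda>t. M / a * t powr c)"
      by (intro continuous_on_mult_left powr)
  next
    fix t :: real assume t: "0 < t" "t < 1"
    show "((\<lambda>t. M / a * t powr c) has_vector_derivative M / b * t powr (c - 1)) (at t)"
      using t assms by (auto intro!: derivative_eq_intros
          simp: c_def simp flip: has_real_derivative_iff_has_vector_derivative)
    have "(r has_field_derivative deriv r (of_real t * z)) (at (of_real t * z))"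
      using r mem[of t] t by (intro holomorphic_derivI[of r \<bbbD>]) auto
    moreover have "((\<lambda>t. of_real t * z) has_vector_derivative z) (at t)"
      by (auto intro!: derivative_eq_intros)
    ultimately have rz: "((\<lambda>t. r (of_real t * z)) has_vector_derivative z * deriv r (of_real t * z)) (at t)"
      using field_vector_diff_chain_at by (fastforce simp: o_def)
    have "((\<lambda>t. complex_of_real (t powr c)) has_vector_derivative of_real (c * t powr (c - 1))) (at t)"
      using t by (intro has_vector_derivative_of_real) (auto intro!: derivative_eq_intros
          simp flip: has_real_derivative_iff_has_vector_derivative)
    from has_vector_derivative_mult[OF this rz] have "(f has_vector_derivative
        of_real (t powr c) * (z * deriv r (of_real t * z)) + of_real (c * t powr (c - 1)) * r (of_real t * z)) (at t)"
      unfolding f_def .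
    moreover have "t powr c = t * t powr (c - 1)" using t by (simp add: powr_mult_base)
    ultimately show "(f has_vector_derivative f' t) (at t)"
      using assms by (simp add: f'_def c_def field_simps)
    show "norm (f' t) \<le> M / b * t powr (c - 1)"
      using mult_left_mono[OF bound[OF mem[of t]], of "t powr (c - 1) / b"] t z \<open>b > 0\<close>
      by (simp add: f'_def norm_mult norm_divide mult.commute)
  qed simp
  then show ?thesis by (simp add: f_def)
qed

theorem theorem3p4:
  fixes \<beta>\<^sub>1 \<beta>\<^sub>2 :: real and p :: "complex \<Rightarrow> complex"
  assumes "\<beta>\<^sub>1 > 0" and "\<beta>\<^sub>2 > 0" and "2 * \<beta>\<^sub>1 - \<beta>\<^sub>2 \<ge> 4"
    and "p holomorphic_on \<bbbD>" and "p 0 = 1"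
    and "(\<lambda>z. 1 + of_real \<beta>\<^sub>1 * z * deriv p z + of_real \<beta>\<^sub>2 * z\<^sup>2 * deriv (deriv p) z)
           \<prec>\<^sub>\<bbbD> (\<lambda>z. z + csqrt (1 + z\<^sup>2))"
  shows "p \<prec>\<^sub>\<bbbD> (\<lambda>z. 1 + arsinh z)"
proof -
  note p = assms(4)
  define G where "G = (\<lambda>z. of_real \<beta>\<^sub>1 * deriv p z + of_real \<beta>\<^sub>2 * z * deriv (deriv p) z)"
  \<comment> \<open>\<open>z * G z\<close> is the subordinate function minus 1, so the lune bound
    makes \<open>F\<close> a self-map of the disc fixing 0. The Schwarz lemma then removes the
    factor \<open>z\<close> and bounds \<open>G\<close>.\<close>
  define F where "F = (\<lambda>z. z * G z / of_real (sqrt 2))"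
  have p': "deriv p holomorphic_on \<bbbD>" by (simp add: holomorphic_deriv p)
  then have p'': "deriv (deriv p) holomorphic_on \<bbbD>" by (simp add: holomorphic_deriv)
  obtain w where w: "\<And>z. z \<in> \<bbbD> \<Longrightarrow> norm (w z) \<le> norm z"
    "\<And>z. z \<in> \<bbbD> \<Longrightarrow> 1 + of_real \<beta>\<^sub>1 * z * deriv p z + of_real \<beta>\<^sub>2 * z\<^sup>2 * deriv (deriv p) z
        = w z + csqrt (1 + (w z)\<^sup>2)"
    using assms(6) unfolding subordinate_def by blast
  have F1: "norm (F z) < 1" if "norm z < 1" for z
  proof -
    have "z * G z = w z + csqrt (1 + (w z)\<^sup>2) - 1"
      using w(2)[of z] that by (simp add: G_def algebra_simps power2_eq_square)
    moreover have "norm (w z) < 1" using w(1)[of z] that by simp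
    ultimately show ?thesis
      using norm_lune_less_sqrt2[of "w z"] by (simp add: F_def norm_divide)
  qed
  have F_hol: "F holomorphic_on \<bbbD>"
    using p' p'' by (auto simp: F_def G_def intro!: holomorphic_intros)
  have G: "norm (G z) \<le> sqrt 2" if z: "z \<in> \<bbbD>" for z
  proof (cases "z = 0")
    \<comment> \<open>At 0 one cannot divide by \<open>z\<close>; the derivative part of the Schwarz
      lemma is used instead, as \<open>F\<close> has derivative \<open>G 0 / sqrt 2\<close>
      there.\<close>
    case True
    have "G holomorphic_on \<bbbD>" using p' p'' by (auto simp: G_def intro!: holomorphic_intros)
    then have "(G has_field_derivative deriv G 0) (at 0)" by (intro holomorphic_derivI) auto
    then have "(F has_field_derivative G 0 / of_real (sqrt 2)) (at 0)"
      unfolding F_def by (auto intro!: derivative_eq_intros)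
    moreover have "norm (deriv F 0) \<le> 1"
      by (rule Schwarz_Lemma[OF F_hol, where \<xi> = 0]) (use F1 in \<open>auto simp: F_def\<close>)
    ultimately show ?thesis using True by (simp add: DERIV_imp_deriv norm_divide)
  next
    case False
    have "norm (F z) \<le> norm z"
      by (rule Schwarz_Lemma[OF F_hol]) (use F1 z in \<open>auto simp: F_def\<close>)
    then show ?thesis using False by (simp add: F_def norm_mult norm_divide field_simps)
  qed
  have p'_bound: "norm (deriv p z) \<le> sqrt 2 / \<beta>\<^sub>1" if "z \<in> \<bbbD>" for z
    using first_order_euler_bound[OF p' assms(1,2), of "sqrt 2" z] G that by (auto simp: G_def)
  have p1: "norm (p z - 1) < 1 / sqrt 2" if z: "z \<in> \<bbbD>" for z
  proof -
    have "(p has_field_derivative deriv p v) (at v within \<bbbD>)" if "v \<in> \<bbbD>" for v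
      using holomorphic_derivI[OF p open_ball that] by (rule has_field_derivative_at_within)
    then have "norm (p z - p 0) \<le> sqrt 2 / \<beta>\<^sub>1 * norm (z - 0)"
      using z p'_bound by (intro field_differentiable_bound[where S = \<bbbD> and f' = "deriv p"]) auto
    also have "\<dots> \<le> sqrt 2 / \<beta>\<^sub>1" using z assms by (intro mult_left_le) auto
    \<comment> \<open>From \<open>2 * \<beta>\<^sub>1 \<ge> 4 + \<beta>\<^sub>2 > 4\<close> follows
      \<open>\<beta>\<^sub>1 > 2\<close>.\<close>
    also have "\<dots> < sqrt 2 / 2" using assms by (intro divide_strict_left_mono) auto
    also have "\<dots> = 1 / sqrt 2" by (simp add: field_simps)
    finally show ?thesis using assms by simp
  qed
  define v where "v = (\<lambda>z. sinh (p z - 1))"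
  have v_hol: "v holomorphic_on \<bbbD>" unfolding v_def sinh_field_def by (intro holomorphic_intros p) auto
  have v0: "v 0 = 0" using assms by (simp add: v_def)
  have v1: "norm (v z) < 1" if "norm z < 1" for z
    using norm_sinh_less_1 p1 that by (simp add: v_def)
  \<comment> \<open>Second use of the Schwarz lemma, now for the subordinating function
    \<open>v\<close> itself.\<close>
  have "norm (v z) \<le> norm z" if "z \<in> \<bbbD>" for z
    by (rule Schwarz_Lemma) (use v_hol v0 v1 that in auto)
  moreover have "p z = 1 + arsinh (v z)" if "z \<in> \<bbbD>" for z
  proof -
    have "\<bar>Im (p z - 1)\<bar> < 1 / sqrt 2" using p1[OF that] abs_Im_le_cmod[of "p z - 1"] by linarith
    also have "\<dots> \<le> 1" by simp
    also have "\<dots> < pi / 2" using pi_gt3 by simp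
    finally show ?thesis by (simp add: v_def arsinh_sinh_complex)
  qed
  ultimately show ?thesis
    unfolding subordinate_def using v_hol v0 by blast
qed

end
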